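(* Let $\mathbf f^{\mathrm V}:\Omega^{\mathrm V}\subseteq\mathbb R^{n_v}\to\mathbb R^{n_v}$ be the vector function of nonlinear valve head-loss terms, with components $f^{\mathrm V}_i(\mathbf u)=o_i\,R_i\,q_i|q_i|^{\mu-1}$ for $\mathbf u=(q_1,\dots,q_{n_v})\in\Omega^{\mathrm V}=[q_1^{\min},q_1^{\max}]\times\dots\times[q_{n_v}^{\min},q_{n_v}^{\max}]$, where $R_i>0$ and $o_i\in(0,1]$ for every $i$, and $1\le\mu\le 3$, are fixed. Then $\mathbf f^{\mathrm V}$ is Lipschitz continuous on $\Omega^{\mathrm V}$ with constant $$K^{\mathrm V}=\mu\,\max_i\ o_iR_i\bigl(\max\{|q_i^{\min}|,|q_i^{\max}|\}\bigr)^{\mu-1}.$$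
   Context: A function $\mathbf f:\Omega\subseteq\mathbb R^n\to\mathbb R^m$ is Lipschitz continuous on $\Omega$ with constant $K\ge 0$ if $\|\mathbf f(\mathbf z_1)-\mathbf f(\mathbf z_2)\|_2\le K\|\mathbf z_1-\mathbf z_2\|_2$ for all $\mathbf z_1,\mathbf z_2\in\Omega$, where $\|\cdot\|_2$ is the Euclidean norm. In a water distribution network with $n_v\ge 1$ (general purpose) valves, $q_i$ is the flow rate through valve $i$, confined to the known compact interval $[q_i^{\min},q_i^{\max}]$; $R_i$ is its friction coefficient, $o_i$ its openness, and $\mu$ the flow exponent, the same for all valves. For $\mu=1$, powers with exponent $\mu-1=0$ are read as $1$. *)

theory Defs
  imports "HOL-Analysis.Analysis"
begin

text \<open>Real powers with exponent \<open>0\<close> read as \<open>1\<close>. The library has \<^prop>\<open>0 powr 0 = (0::real)\<close>,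
  so plain \<open>powr\<close> would be wrong for base \<open>0\<close> and \<open>\<mu> = 1\<close>.\<close>

definition rpow :: "real \<Rightarrow> real \<Rightarrow> real" where
  "rpow x a = (if a = 0 then 1 else x powr a)"

definition valve_domain :: "real ^ 'n \<Rightarrow> real ^ 'n \<Rightarrow> (real ^ 'n) set" where
  "valve_domain qmin qmax = {u. \<forall>i. u $ i \<in> {qmin $ i..qmax $ i}}"

text \<open>Valve head losses, for openness \<open>op\<close>, friction coefficients \<open>R\<close> and flow exponent \<open>\<mu>\<close>.\<close>

definition valve_headloss :: "real ^ 'n \<Rightarrow> real ^ 'n \<Rightarrow> real \<Rightarrow> real ^ 'n \<Rightarrow> real ^ 'n" where
  "valve_headloss op R \<mu> u = (\<chi> i. op $ i * R $ i * (u $ i * rpow \<bar>u $ i\<bar> (\<mu> - 1)))"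

definition valve_lipschitz_const ::
    "real ^ 'n \<Rightarrow> real ^ 'n \<Rightarrow> real \<Rightarrow> real ^ 'n \<Rightarrow> real ^ 'n \<Rightarrow> real" where
  "valve_lipschitz_const op R \<mu> qmin qmax =
     \<mu> * (MAX i. op $ i * R $ i * rpow (max \<bar>qmin $ i\<bar> \<bar>qmax $ i\<bar>) (\<mu> - 1))"

end

theory Submission
  imports Defs
begin

text \<open>Each component of the head loss is a positive multiple of the signed power
  \<open>x |x|\<^bsup>\<mu>-1\<^esup>\<close> of one coordinate, so the map acts diagonally. The signed power has derivative
  \<open>\<mu> |x|\<^bsup>\<mu>-1\<^esup>\<close> away from \<open>0\<close>, which on \<open>[-m, m]\<close> is at most \<open>\<mu> m\<^bsup>\<mu>-1\<^esup>\<close>. Hence the mean value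
  theorem gives this Lipschitz constant on either half of the interval
  (\<open>signed_power_diff_le_same_sign\<close>). Differentiability at \<open>0\<close> is avoided: for arguments of
  opposite sign the two values have opposite sign as well, and it suffices to bound each of
  them by \<open>m\<^bsup>\<mu>-1\<^esup>\<close> times its argument (\<open>signed_power_lipschitz\<close>). Taking \<open>m\<close> to be the largest
  flow magnitude that valve \<open>i\<close> admits bounds the \<open>i\<close>-th component; a diagonal map whose
  components all have Lipschitz constant \<open>K\<close> has Lipschitz constant \<open>K\<close> for the Euclidean
  norm.\<close>

lemma rpow_nonneg: "0 \<le> rpow x a"
  by (simp add: rpow_def)

lemma rpow_mono: "0 \<le> x \<Longrightarrow> x \<le> y \<Longrightarrow> 0 \<le> a \<Longrightarrow> rpow x a \<le> rpow y a"
  by (simp add: rpow_def powr_mono2)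

lemma mult_rpow_eq_powr:
  assumes "0 \<le> x"
  shows "x * rpow x (\<mu> - 1) = x powr \<mu>"
  using assms by (cases "x = 0") (auto simp: rpow_def powr_diff)

lemma signed_power_diff_le_same_sign:
  assumes "0 \<le> x" "x \<le> y" "y \<le> m" "1 \<le> \<mu>"
  shows "\<bar>y * rpow y (\<mu> - 1) - x * rpow x (\<mu> - 1)\<bar> \<le> \<mu> * rpow m (\<mu> - 1) * (y - x)"
proof (cases "x = y")
  case False
  with assms have "x < y" by simp
  have "continuous_on {x..y} (\<lambda>z. z powr \<mu>)"
    using assms by (intro continuous_on_powr' continuous_intros) auto
  moreover have "((\<lambda>z. z powr \<mu>) has_derivative (\<lambda>h. \<mu> * z powr (\<mu> - 1) * h)) (at z)"
    if "x < z" for z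
    using has_real_derivative_powr[of z \<mu>] that assms by (simp add: has_field_derivative_def)
  ultimately obtain z where z: "x < z" "z < y"
    and eq: "y powr \<mu> - x powr \<mu> = \<mu> * z powr (\<mu> - 1) * (y - x)"
    using \<open>x < y\<close> mvt[of x y "\<lambda>z. z powr \<mu>" "\<lambda>z h. \<mu> * z powr (\<mu> - 1) * h"] by auto
  \<comment> \<open>Since \<open>z > 0\<close>, the two readings of the power agree, also for \<open>\<mu> = 1\<close>.\<close>
  have "z powr (\<mu> - 1) = rpow z (\<mu> - 1)"
    using z assms by (simp add: rpow_def)
  also have "\<dots> \<le> rpow m (\<mu> - 1)"
    using z assms by (intro rpow_mono) auto
  finally have "\<mu> * z powr (\<mu> - 1) * (y - x) \<le> \<mu> * rpow m (\<mu> - 1) * (y - x)"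
    using \<open>x < y\<close> assms by (intro mult_right_mono mult_left_mono) auto
  moreover have "0 \<le> \<mu> * z powr (\<mu> - 1) * (y - x)"
    using \<open>x < y\<close> assms by simp
  ultimately show ?thesis
    using eq assms by (simp add: mult_rpow_eq_powr)
qed simp

lemma signed_power_lipschitz:
  assumes "\<bar>x\<bar> \<le> m" "\<bar>y\<bar> \<le> m" "1 \<le> \<mu>"
  shows "\<bar>x * rpow \<bar>x\<bar> (\<mu> - 1) - y * rpow \<bar>y\<bar> (\<mu> - 1)\<bar> \<le> \<mu> * rpow m (\<mu> - 1) * \<bar>x - y\<bar>"
  using assms
proof (induction x y rule: linorder_wlog)
  case (le x y)
  let ?r = "\<lambda>t. rpow t (\<mu> - 1)"
  consider "0 \<le> x" | "y \<le> 0" | "x < 0" "0 < y" by linarith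
  then show ?case
  proof cases
    case 1
    then show ?thesis
      using signed_power_diff_le_same_sign[of x y m \<mu>] le by (simp add: abs_minus_commute)
  next
    \<comment> \<open>The signed power is odd.\<close>
    case 2
    then show ?thesis
      using signed_power_diff_le_same_sign[of "- y" "- x" m \<mu>] le by (simp add: abs_minus_commute)
  next
    case 3
    have "(- x) * ?r (- x) \<le> (- x) * ?r m" "y * ?r y \<le> y * ?r m"
      using 3 le by (intro mult_left_mono rpow_mono; simp)+
    moreover have "0 \<le> (- x) * ?r (- x)" "0 \<le> y * ?r y"
      using 3 rpow_nonneg by (intro mult_nonneg_nonneg; simp)+
    ultimately have "\<bar>x * ?r (- x) - y * ?r y\<bar> \<le> 1 * (?r m * (y - x))"
      by (simp add: algebra_simps)
    also have "\<dots> \<le> \<mu> * (?r m * (y - x))"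
      using 3 le rpow_nonneg by (intro mult_right_mono mult_nonneg_nonneg) auto
    finally show ?thesis
      using 3 by (simp add: mult.assoc)
  qed
qed (simp add: abs_minus_commute)

lemma lipschitz_on_componentwise_cart:
  fixes f :: "real ^ 'n \<Rightarrow> real ^ 'n"
  assumes "0 \<le> K"
    and "\<And>u v i. u \<in> S \<Longrightarrow> v \<in> S \<Longrightarrow> \<bar>f u $ i - f v $ i\<bar> \<le> K * \<bar>u $ i - v $ i\<bar>"
  shows "K-lipschitz_on S f"
proof (rule lipschitz_onI)
  fix u v assume "u \<in> S" "v \<in> S"
  then have "norm (f u - f v) \<le> norm (K *\<^sub>R (u - v))"
    using assms by (intro norm_le_componentwise_cart) (simp add: abs_mult)
  then show "dist (f u) (f v) \<le> K * dist u v"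
    using assms(1) by (simp add: dist_norm)
qed (rule assms(1))

theorem proposition3:
  fixes op R qmin qmax :: "real ^ 'n" and \<mu> :: real
  assumes "\<And>i. qmin $ i \<le> qmax $ i"
    and "\<And>i. 0 < R $ i"
    and "\<And>i. op $ i \<in> {0<..1}"
    and "1 \<le> \<mu>" and "\<mu> \<le> 3"
  shows "(valve_lipschitz_const op R \<mu> qmin qmax)-lipschitz_on
           (valve_domain qmin qmax) (valve_headloss op R \<mu>)"
proof -
  define m where "m i = max \<bar>qmin $ i\<bar> \<bar>qmax $ i\<bar>" for i
  define c where "c i = op $ i * R $ i" for i
  define K where "K = valve_lipschitz_const op R \<mu> qmin qmax"
  have c: "0 \<le> c i" for i
    using assms(2,3)[of i] by (simp add: c_def)
  have K: "\<mu> * (c i * rpow (m i) (\<mu> - 1)) \<le> K" for i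
    unfolding K_def valve_lipschitz_const_def c_def m_def
    using assms(4) by (intro mult_left_mono Max_ge) auto
  show ?thesis
    unfolding K_def[symmetric]
  proof (rule lipschitz_on_componentwise_cart)
    have "0 \<le> \<mu> * (c i * rpow (m i) (\<mu> - 1))" for i
      using c assms(4) by (simp add: rpow_nonneg)
    then show "0 \<le> K"
      using K order_trans by blast
  next
    fix u v i
    assume "u \<in> valve_domain qmin qmax" "v \<in> valve_domain qmin qmax"
    then have "u $ i \<in> {qmin $ i..qmax $ i}" "v $ i \<in> {qmin $ i..qmax $ i}"
      by (simp_all add: valve_domain_def)
    then have "\<bar>u $ i\<bar> \<le> m i" "\<bar>v $ i\<bar> \<le> m i"
      by (auto simp: m_def)
    then have "\<bar>u $ i * rpow \<bar>u $ i\<bar> (\<mu> - 1) - v $ i * rpow \<bar>v $ i\<bar> (\<mu> - 1)\<bar>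
        \<le> \<mu> * rpow (m i) (\<mu> - 1) * \<bar>u $ i - v $ i\<bar>" (is "\<bar>?d\<bar> \<le> _")
      using assms(4) by (rule signed_power_lipschitz)
    then have "c i * \<bar>?d\<bar> \<le> c i * (\<mu> * rpow (m i) (\<mu> - 1) * \<bar>u $ i - v $ i\<bar>)"
      using c by (rule mult_left_mono)
    also have "\<dots> = \<mu> * (c i * rpow (m i) (\<mu> - 1)) * \<bar>u $ i - v $ i\<bar>"
      by (simp add: ac_simps)
    also have "\<dots> \<le> K * \<bar>u $ i - v $ i\<bar>"
      using K by (rule mult_right_mono) simp
    finally have "c i * \<bar>?d\<bar> \<le> K * \<bar>u $ i - v $ i\<bar>" .
    moreover have "valve_headloss op R \<mu> u $ i - valve_headloss op R \<mu> v $ i = c i * ?d"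
      by (simp add: valve_headloss_def c_def right_diff_distrib)
    ultimately show "\<bar>valve_headloss op R \<mu> u $ i - valve_headloss op R \<mu> v $ i\<bar>
        \<le> K * \<bar>u $ i - v $ i\<bar>"
      using c[of i] by (simp add: abs_mult)
  qed
qed

end
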